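(* Let $z_\star$ be the unique fixed point of the exact DRS map $T=(1-\alpha)I+\alpha R_{\gamma g}R_{\gamma f}$ and set $p_\star:=P_{\gamma f}z_\star$. For the certified CR-DRS algorithm described in the context, let for each $k$ $$p_k=P_{\gamma f}z_k,\qquad d_k:=a_{k-1}-p_k,\qquad \overline G_k:=\int_0^1\nabla^2\phi_k(p_k+td_k)\,dt .$$ Assume $d_k\to0$, $d_k\neq0$, $a_{k-1}\to p_\star$, $p_k\to p_\star$, and that $\nabla^2f$ is continuous near $p_\star$. Write the actual transported candidate as $$\widehat x_k=a_{k-1}-\eta_k^{\rm eff}H_kr_k(a_{k-1})+\xi_k,$$ where $\eta_k^{\rm eff}=1-\prod_{j=0}^{K-1}(1-\eta_{k,j})$ is the effective damping (or its value after any explicit cap), and $\xi_k\in\mathcal H$ is the remaining displacement change caused by clipping or truncation. Assume the direct and inverse models are paired, $B_k=H_k^{-1}$. Suppose $$\sup_k\|H_k\|<\infty,\qquad \eta_k^{\rm eff}\to1,\qquad \frac{\|(B_k-\overline G_k)d_k\|}{\|d_k\|}\to0,\qquad \frac{\|\xi_k\|}{\|d_k\|}\to0 .$$ Then $$\frac{\|\widehat x_k-p_k\|}{\|a_{k-1}-p_k\|}\longrightarrow0 .$$ Moreover, for every fixed $\theta_Q\in(0,1)$ and $c_A\in(0,1/2)$, the three tests $$\langle r_k(a_{k-1}),\widehat x_k-a_{k-1}\rangle<0,\qquad \|r_k(\widehat x_k)\|\le\frac mL\theta_Q\|r_k(a_{k-1})\|,$$ $$\phi_k(\widehat x_k)\le\phi_k(a_{k-1})+c_A\langle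 r_k(a_{k-1}),\widehat x_k-a_{k-1}\rangle$$ hold for all sufficiently large $k$. Hence the algorithm eventually accepts the transported candidate with one new gradient and does not call the fallback block.
   Context: Setting and notation. $\mathcal H$ is a finite-dimensional real Hilbert space, $f:\mathcal H\to\mathbb R$ is convex and twice continuously differentiable, $\sigma$-strongly convex and $\beta$-smooth ($\nabla f$ is $\beta$-Lipschitz) with $0<\sigma\le\beta$, $g:\mathcal H\to\mathbb R\cup\{+\infty\}$ is proper, closed, convex. For a proper closed convex $h$ and $\gamma>0$, $P_{\gamma h}u:=\arg\min_x\{\gamma h(x)+\frac12\|x-u\|^2\}$ and $R_{\gamma h}:=2P_{\gamma h}-I$. Fix $\gamma>0,\alpha>0$ with $\rho:=|1-\alpha|+\alpha\delta<1$, where $\delta:=\max\{\frac{\gamma\beta-1}{\gamma\beta+1},\frac{1-\gamma\sigma}{1+\gamma\sigma}\}$ (then $T$ is a contraction with a unique fixed point). For a center $z_k$ put $\phi_k(x):=\gamma f(x)+\frac12\|x-z_k\|^2$ and $r_k(x):=\nabla\phi_k(x)=\gamma\nabla f(x)+x-z_k$. For vectors $a,b$, $ab^\top$ is the operator $h\mapsto\langle b,h\rangle a$. Certified CR-DRS algorithm. Parameters: $\gamma>0$ and $\alpha>0$ with $|1-\alpha|+\alpha\max\{\frac{\gamma\beta-1}{\gamma\beta+1},\frac{1-\gamma\sigma}{1+\gamma\sigma}\}<1$, integers $K\ge0$ and $b\ge1$, memory cap $m_q\in\{1,2,\dots\}\cup\{\infty\}$, $c_A\in(0,1/2)$, $\theta_Q\in(0,1)$,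 $\nu_{\rm qn}\in(0,2)$, caps $\bar\eta_k\in(0,1]$ fixed before the rollout at iteration $k$ from stored information (reference policy: $\bar\eta_k\equiv\bar\eta$), $\epsilon_{\rm curv}\in[0,1)$, $\epsilon_{\rm sr1}\in(0,1)$, $0<\underline h\le\overline h<\infty$, $\vartheta_0\in[\underline h,\overline h]$, and an update type (BFGS or SR1). $m:=1+\gamma\sigma$, $L:=1+\gamma\beta$. Inputs: $z_0,a_{-1}\in\mathcal H$ and an initial ordered memory $\mathcal M_0$ of at most $m_q$ accepted exact secant pairs. An exact secant pair is $(s,q)$ with $s=v-u$, $q=\gamma(\nabla f(v)-\nabla f(u))+s$. For $k=0,1,2,\dots$: 1. Set $\bar r_k:=r_k(a_{k-1})$. 2. Build self-adjoint positive definite $H_k$ and $B_k=H_k^{-1}$: start from $H=\vartheta_kI$, $B=\vartheta_k^{-1}I$, where $\vartheta_k=\min\{\overline h,\max\{\underline h,\langle s_\ell,q_\ell\rangle/\|q_\ell\|^2\}\}$ with $(s_\ell,q_\ell)$ the newest pair of $\mathcal M_k$ (and $\vartheta_k=\vartheta_0$ if $\mathcal M_k=\emptyset$); then process the pairs $(s,y)$ of $\mathcal M_k$ in chronological order. BFGS: with $\omega=1/\langle s,y\rangle$ ($\langle s,y\rangle>0$) and $V=I-\omega sy^\top$, $H^+=VHV^\top+\omega ss^\top$, $B^+=B-\frac{Bss^\top B}{\langle s,Bs\rangle}+\frac{yy^\top}{\langle s,y\rangle}$. Safeguarded SR1: with $u=s-Hy$, $v=y-Bs$ and nonzero denominators,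 $H^+=H+\frac{uu^\top}{\langle u,y\rangle}$, $B^+=B+\frac{vv^\top}{\langle v,s\rangle}$, performed only if $|\langle u,y\rangle|\ge\epsilon_{\rm sr1}\|u\|\|y\|$, $\underline hI\preceq H^+\preceq\overline hI$ and $\overline h^{-1}I\preceq B^+\preceq\underline h^{-1}I$; otherwise the pair is skipped. 3. Predictor: $\widetilde x_{k,0}=a_{k-1}$, $\widetilde r_{k,0}=\bar r_k$. For $j=0,\dots,K-1$: $d_{k,j}=-H_k\widetilde r_{k,j}$; $\eta_{k,j}=\min\{\bar\eta_k,\ \nu_{\rm qn}\frac{-\langle\widetilde r_{k,j},d_{k,j}\rangle}{\langle d_{k,j},B_kd_{k,j}\rangle}\}$ if $d_{k,j}\ne0$, $\langle\widetilde r_{k,j},d_{k,j}\rangle<0$ and $\langle d_{k,j},B_kd_{k,j}\rangle>0$, and $\eta_{k,j}=0$ otherwise (then all later pseudo-states equal the current one); $\widetilde x_{k,j+1}=\widetilde x_{k,j}+\eta_{k,j}d_{k,j}$; $\widetilde r_{k,j+1}=\widetilde r_{k,j}+B_k(\widetilde x_{k,j+1}-\widetilde x_{k,j})$. Candidate: $\widehat x_k=\widetilde x_{k,K}$ ($=a_{k-1}$, with $\eta_k^{\rm eff}=0$, if $K=0$). The displacement may additionally be clipped or truncated; this is what $\xi_k$ accounts for. 4. Evaluate one new gradient $\nabla f(\widehat x_k)$ and accept, $x_k:=\widehat x_k$, if all three tests hold: $\langle\bar r_k,\widehat x_k-a_{k-1}\rangle<0$; $\phi_k(\widehat x_k)\le\phi_k(a_{k-1})+c_A\langle\bar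 r_k,\widehat x_k-a_{k-1}\rangle$; $\|r_k(\widehat x_k)\|\le\frac mL\theta_Q\|\bar r_k\|$. 5. Otherwise (fallback block) set $u_0=a_{k-1}$, $u_{j+1}=u_j-\tau_Gr_k(u_j)$ with $\tau_G=\frac{2}{m+L}$ for $j=0,\dots,b-1$, and $x_k:=u_b$. 6. Memory: $\mathcal M_{k+1}$ is $\mathcal M_k$ with $(s_k,q_k)=(x_k-a_{k-1},\,r_k(x_k)-\bar r_k)$ appended only if $\langle s_k,q_k\rangle\ge\epsilon_{\rm curv}\|s_k\|\|q_k\|$ and the safeguards of the chosen update hold; the oldest pair is discarded if the memory would exceed $m_q$. 7. $y_k^g=P_{\gamma g}(2x_k-z_k)$, $z_{k+1}=z_k+2\alpha(y_k^g-x_k)$, and $a_k:=x_k$. *)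

theory Defs
  imports "HOL-Analysis.Analysis"
begin

section \<open>Gradients, Hessians and the standing classes of functions\<close>

definition grad :: "('a::euclidean_space \<Rightarrow> real) \<Rightarrow> 'a \<Rightarrow> 'a" where
  "grad f x = (THE D. GDERIV f x :> D)"

definition hess :: "('a::euclidean_space \<Rightarrow> real) \<Rightarrow> 'a \<Rightarrow> 'a \<Rightarrow>\<^sub>L 'a" where
  "hess f x = Blinfun (frechet_derivative (grad f) (at x))"

definition twice_cont_diff :: "('a::euclidean_space \<Rightarrow> real) \<Rightarrow> bool" where
  "twice_cont_diff f \<longleftrightarrow>
     (\<forall>x. f differentiable (at x)) \<and> (\<forall>x. grad f differentiable (at x)) \<and>
     continuous_on UNIV (hess f)"

definition strongly_convex :: "real \<Rightarrow> ('a::euclidean_space \<Rightarrow> real) \<Rightarrow> bool" where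
  "strongly_convex \<sigma> f \<longleftrightarrow>
     (\<forall>x y. \<forall>t\<in>{0..1}. f ((1 - t) *\<^sub>R x + t *\<^sub>R y)
        \<le> (1 - t) * f x + t * f y - \<sigma> / 2 * t * (1 - t) * (norm (x - y))\<^sup>2)"

definition ereal_epigraph :: "('a \<Rightarrow> ereal) \<Rightarrow> ('a \<times> real) set" where
  "ereal_epigraph h = {(x, t). h x \<le> ereal t}"

definition proper_closed_convex :: "('a::euclidean_space \<Rightarrow> ereal) \<Rightarrow> bool" where
  "proper_closed_convex h \<longleftrightarrow>
     (\<forall>x. h x \<noteq> -\<infinity>) \<and> (\<exists>x. h x \<noteq> \<infinity>) \<and>
     closed (ereal_epigraph h) \<and> convex (ereal_epigraph h)"


section \<open>Proximal maps and the DRS map\<close>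

definition prox :: "real \<Rightarrow> ('a::euclidean_space \<Rightarrow> ereal) \<Rightarrow> 'a \<Rightarrow> 'a" where
  "prox \<gamma> h u = (ARG_MIN (\<lambda>x. ereal \<gamma> * h x + ereal (1/2 * (norm (x - u))\<^sup>2)) x. True)"

definition reflected_prox :: "real \<Rightarrow> ('a::euclidean_space \<Rightarrow> ereal) \<Rightarrow> 'a \<Rightarrow> 'a" where
  "reflected_prox \<gamma> h u = 2 *\<^sub>R prox \<gamma> h u - u"

definition drs_map ::
  "real \<Rightarrow> real \<Rightarrow> ('a::euclidean_space \<Rightarrow> real) \<Rightarrow> ('a \<Rightarrow> ereal) \<Rightarrow> 'a \<Rightarrow> 'a" where
  "drs_map \<alpha> \<gamma> f g z =
     (1 - \<alpha>) *\<^sub>R z + \<alpha> *\<^sub>R reflected_prox \<gamma> g (reflected_prox \<gamma> (\<lambda>x. ereal (f x)) z)"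

definition phi :: "real \<Rightarrow> ('a::euclidean_space \<Rightarrow> real) \<Rightarrow> 'a \<Rightarrow> 'a \<Rightarrow> real" where
  "phi \<gamma> f z x = \<gamma> * f x + 1/2 * (norm (x - z))\<^sup>2"

definition resid :: "real \<Rightarrow> ('a::euclidean_space \<Rightarrow> real) \<Rightarrow> 'a \<Rightarrow> 'a \<Rightarrow> 'a" where
  "resid \<gamma> f z x = \<gamma> *\<^sub>R grad f x + x - z"

lemma grad_eqI:
  fixes f :: "'a::euclidean_space \<Rightarrow> real"
  assumes "GDERIV f x :> D"
  shows "grad f x = D"
  unfolding grad_def
proof (rule the_equality, rule assms)
  fix E assume "GDERIV f x :> E"
  then have "(\<lambda>h. h \<bullet> E) = (\<lambda>h. h \<bullet> D)"
    using assms has_derivative_unique unfolding gderiv_def by blast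
  then show "E = D"
    by (metis vector_eq_ldot)
qed

lemma GDERIV_grad:
  fixes f :: "'a::euclidean_space \<Rightarrow> real"
  assumes "f differentiable (at x)"
  shows "GDERIV f x :> grad f x"
proof -
  obtain f' where f': "(f has_derivative f') (at x)"
    using assms by (auto simp: differentiable_def)
  then have lin: "linear f'"
    by (rule has_derivative_linear)
  have "f' = (\<lambda>h. h \<bullet> adjoint f' 1)"
    using adjoint_works[OF lin, of _ 1] by (simp add: fun_eq_iff)
  then have "GDERIV f x :> adjoint f' 1"
    using f' unfolding gderiv_def by simp
  then show ?thesis
    using grad_eqI by metis
qed

lemma resid_eq_grad_phi:
  fixes f :: "'a::euclidean_space \<Rightarrow> real"
  assumes "f differentiable (at x)"
  shows "resid \<gamma> f z x = grad (phi \<gamma> f z) x"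
proof -
  have "(f has_derivative (\<lambda>h. h \<bullet> grad f x)) (at x)"
    using GDERIV_grad[OF assms] by (simp add: gderiv_def)
  then have "((\<lambda>y. \<gamma> * f y + 1/2 * ((y - z) \<bullet> (y - z)))
      has_derivative (\<lambda>h. h \<bullet> resid \<gamma> f z x)) (at x)"
    by (auto intro!: derivative_eq_intros
        simp: resid_def inner_add_right inner_diff_right inner_diff_left inner_commute algebra_simps)
  then have "GDERIV (phi \<gamma> f z) x :> resid \<gamma> f z x"
    by (simp add: gderiv_def phi_def[abs_def] dot_square_norm)
  then show ?thesis
    using grad_eqI by metis
qed


section \<open>Quasi-Newton models\<close>

text \<open>The operator \<open>a b\<^sup>T\<close>, that is \<open>h \<mapsto> (b \<bullet> h) a\<close>.\<close>

definition outer :: "'a::euclidean_space \<Rightarrow> 'a \<Rightarrow> 'a \<Rightarrow>\<^sub>L 'a" where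
  "outer a b = blinfun_scaleR_left a o\<^sub>L blinfun_inner_right b"

lemma outer_apply [simp]: "blinfun_apply (outer a b) h = (b \<bullet> h) *\<^sub>R a"
  by (simp add: outer_def)

definition transp :: "('a::euclidean_space \<Rightarrow>\<^sub>L 'a) \<Rightarrow> 'a \<Rightarrow>\<^sub>L 'a" where
  "transp A = Blinfun (adjoint (blinfun_apply A))"

definition loewner_le :: "('a::euclidean_space \<Rightarrow>\<^sub>L 'a) \<Rightarrow> ('a \<Rightarrow>\<^sub>L 'a) \<Rightarrow> bool" where
  "loewner_le A B \<longleftrightarrow> (\<forall>x. x \<bullet> A x \<le> x \<bullet> B x)"

definition self_adjoint_pos_def :: "('a::euclidean_space \<Rightarrow>\<^sub>L 'a) \<Rightarrow> bool" where
  "self_adjoint_pos_def A \<longleftrightarrow>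
     (\<forall>x y. A x \<bullet> y = x \<bullet> A y) \<and> (\<forall>x. x \<noteq> 0 \<longrightarrow> 0 < x \<bullet> A x)"

definition inverse_pair :: "('a::euclidean_space \<Rightarrow>\<^sub>L 'a) \<Rightarrow> ('a \<Rightarrow>\<^sub>L 'a) \<Rightarrow> bool" where
  "inverse_pair H B \<longleftrightarrow> H o\<^sub>L B = id_blinfun \<and> B o\<^sub>L H = id_blinfun"

datatype update_type = BFGS | SR1

text \<open>The parameters are, in this order:
  \<open>\<gamma>, \<alpha>, \<sigma>, \<beta>, K, b, m\<^sub>q, c\<^sub>A, \<theta>\<^sub>Q, \<nu>\<^sub>q\<^sub>n, \<epsilon>\<^sub>c\<^sub>u\<^sub>r\<^sub>v, \<epsilon>\<^sub>s\<^sub>r\<^sub>1\<close>,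
  the lower and upper bounds on the scaling, \<open>\<vartheta>\<^sub>0\<close>, and the update type.\<close>

record crdrs_params =
  gam :: real
  alp :: real
  sig :: real
  bet :: real
  rollK :: nat
  fbb :: nat
  mq :: enat
  cA :: real
  thQ :: real
  nuqn :: real
  epscurv :: real
  epssr1 :: real
  hlo :: real
  hhi :: real
  vth0 :: real
  upd :: update_type

definition mconst :: "crdrs_params \<Rightarrow> real" where
  "mconst P = 1 + gam P * sig P"

definition Lconst :: "crdrs_params \<Rightarrow> real" where
  "Lconst P = 1 + gam P * bet P"

definition params_ok :: "crdrs_params \<Rightarrow> bool" where
  "params_ok P \<longleftrightarrow>
     0 < gam P \<and> 0 < alp P \<and> 0 < sig P \<and> sig P \<le> bet P \<and>
     \<bar>1 - alp P\<bar> + alp P * max ((gam P * bet P - 1) / (gam P * bet P + 1))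
                               ((1 - gam P * sig P) / (1 + gam P * sig P)) < 1 \<and>
     1 \<le> fbb P \<and> 1 \<le> mq P \<and>
     0 < cA P \<and> cA P < 1/2 \<and> 0 < thQ P \<and> thQ P < 1 \<and>
     0 < nuqn P \<and> nuqn P < 2 \<and>
     0 \<le> epscurv P \<and> epscurv P < 1 \<and> 0 < epssr1 P \<and> epssr1 P < 1 \<and>
     0 < hlo P \<and> hlo P \<le> hhi P \<and> hlo P \<le> vth0 P \<and> vth0 P \<le> hhi P"

type_synonym 'a qn_model = "('a \<Rightarrow>\<^sub>L 'a) \<times> ('a \<Rightarrow>\<^sub>L 'a)"

text \<open>A model is a pair \<open>(H, B)\<close> of an inverse and a direct approximation; a memory is a list of
  pairs \<open>(s, q)\<close> in chronological order, the newest pair last.\<close>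

fun bfgs_update :: "'a::euclidean_space \<times> 'a \<Rightarrow> 'a qn_model \<Rightarrow> 'a qn_model" where
  "bfgs_update (s, y) (H, B) =
     (let \<omega> = 1 / (s \<bullet> y); V = id_blinfun - \<omega> *\<^sub>R outer s y in
      (V o\<^sub>L H o\<^sub>L transp V + \<omega> *\<^sub>R outer s s,
       B - (1 / (s \<bullet> B s)) *\<^sub>R (B o\<^sub>L outer s s o\<^sub>L B) + (1 / (s \<bullet> y)) *\<^sub>R outer y y))"

fun sr1_update :: "'a::euclidean_space \<times> 'a \<Rightarrow> 'a qn_model \<Rightarrow> 'a qn_model" where
  "sr1_update (s, y) (H, B) =
     (let u = s - H y; v = y - B s in
      (H + (1 / (u \<bullet> y)) *\<^sub>R outer u u, B + (1 / (v \<bullet> s)) *\<^sub>R outer v v))"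

fun sr1_safe :: "crdrs_params \<Rightarrow> 'a::euclidean_space \<times> 'a \<Rightarrow> 'a qn_model \<Rightarrow> bool" where
  "sr1_safe P (s, y) (H, B) \<longleftrightarrow>
     (let u = s - H y; v = y - B s; (H', B') = sr1_update (s, y) (H, B) in
      u \<bullet> y \<noteq> 0 \<and> v \<bullet> s \<noteq> 0 \<and>
      \<bar>u \<bullet> y\<bar> \<ge> epssr1 P * norm u * norm y \<and>
      loewner_le (hlo P *\<^sub>R id_blinfun) H' \<and> loewner_le H' (hhi P *\<^sub>R id_blinfun) \<and>
      loewner_le ((1 / hhi P) *\<^sub>R id_blinfun) B' \<and> loewner_le B' ((1 / hlo P) *\<^sub>R id_blinfun))"

definition process_pair ::
  "crdrs_params \<Rightarrow> 'a::euclidean_space \<times> 'a \<Rightarrow> 'a qn_model \<Rightarrow> 'a qn_model" where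
  "process_pair P sy HB = (case upd P of
       BFGS \<Rightarrow> bfgs_update sy HB
     | SR1 \<Rightarrow> if sr1_safe P sy HB then sr1_update sy HB else HB)"

definition init_scale :: "crdrs_params \<Rightarrow> ('a::euclidean_space \<times> 'a) list \<Rightarrow> real" where
  "init_scale P M = (if M = [] then vth0 P
     else let (s, q) = last M in min (hhi P) (max (hlo P) ((s \<bullet> q) / (norm q)\<^sup>2)))"

definition build_model :: "crdrs_params \<Rightarrow> ('a::euclidean_space \<times> 'a) list \<Rightarrow> 'a qn_model" where
  "build_model P M = fold (process_pair P) M
     (init_scale P M *\<^sub>R id_blinfun, (1 / init_scale P M) *\<^sub>R id_blinfun)"


section \<open>Memory\<close>

definition exact_secant_pair ::
  "crdrs_params \<Rightarrow> ('a::euclidean_space \<Rightarrow> real) \<Rightarrow> 'a \<times> 'a \<Rightarrow> bool" where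
  "exact_secant_pair P f sq \<longleftrightarrow>
     (\<exists>u v. fst sq = v - u \<and> snd sq = gam P *\<^sub>R (grad f v - grad f u) + fst sq)"

text \<open>Acceptance of a pair into the memory, tested against the model \<open>HB\<close> in use. For BFGS the
  safeguard is the positivity of \<open>s \<bullet> q\<close> that the update formula divides by; it is not implied
  by the curvature test when \<open>\<epsilon>\<^sub>c\<^sub>u\<^sub>r\<^sub>v = 0\<close> or \<open>s = 0\<close>.\<close>

definition accept_pair :: "crdrs_params \<Rightarrow> 'a::euclidean_space qn_model \<Rightarrow> 'a \<times> 'a \<Rightarrow> bool" where
  "accept_pair P HB sq \<longleftrightarrow>
     fst sq \<bullet> snd sq \<ge> epscurv P * norm (fst sq) * norm (snd sq) \<and>
     (case upd P of BFGS \<Rightarrow> fst sq \<bullet> snd sq > 0 | SR1 \<Rightarrow> sr1_safe P sq HB)"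

text \<open>The model against which a pair of the initial memory was accepted is not part of the input,
  hence the existential quantifier.\<close>

definition initial_memory_ok ::
  "crdrs_params \<Rightarrow> ('a::euclidean_space \<Rightarrow> real) \<Rightarrow> ('a \<times> 'a) list \<Rightarrow> bool" where
  "initial_memory_ok P f M \<longleftrightarrow> enat (length M) \<le> mq P \<and>
     (\<forall>sq\<in>set M. exact_secant_pair P f sq \<and>
        (\<exists>H B. self_adjoint_pos_def H \<and> self_adjoint_pos_def B \<and> inverse_pair H B \<and>
               accept_pair P (H, B) sq))"

definition update_memory ::
  "crdrs_params \<Rightarrow> 'a::euclidean_space qn_model \<Rightarrow> 'a \<times> 'a \<Rightarrow> ('a \<times> 'a) list \<Rightarrow> ('a \<times> 'a) list" where
  "update_memory P HB sq M =
     (if accept_pair P HB sq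
      then (let M' = M @ [sq] in if enat (length M') > mq P then tl M' else M')
      else M)"


section \<open>Predictor\<close>

definition qn_damping ::
  "crdrs_params \<Rightarrow> real \<Rightarrow> 'a::euclidean_space qn_model \<Rightarrow> 'a \<Rightarrow> real" where
  "qn_damping P \<eta>bar HB r =
     (let d = - (fst HB) r; B = snd HB in
      if d \<noteq> 0 \<and> r \<bullet> d < 0 \<and> d \<bullet> B d > 0
      then min \<eta>bar (nuqn P * (- (r \<bullet> d) / (d \<bullet> B d))) else 0)"

text \<open>\<open>rollout P \<eta>bar HB a r j\<close> is the pair of the \<open>j\<close>-th pseudo-iterate and pseudo-residual, started
  from \<open>(a, r)\<close>.\<close>

fun rollout ::
  "crdrs_params \<Rightarrow> real \<Rightarrow> 'a::euclidean_space qn_model \<Rightarrow> 'a \<Rightarrow> 'a \<Rightarrow> nat \<Rightarrow> 'a \<times> 'a" where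
  "rollout P \<eta>bar HB a r 0 = (a, r)"
| "rollout P \<eta>bar HB a r (Suc j) =
     (let (x, r') = rollout P \<eta>bar HB a r j;
          x' = x + qn_damping P \<eta>bar HB r' *\<^sub>R (- (fst HB) r')
      in (x', r' + (snd HB) (x' - x)))"

definition rollout_damping ::
  "crdrs_params \<Rightarrow> real \<Rightarrow> 'a::euclidean_space qn_model \<Rightarrow> 'a \<Rightarrow> 'a \<Rightarrow> nat \<Rightarrow> real" where
  "rollout_damping P \<eta>bar HB a r j = qn_damping P \<eta>bar HB (snd (rollout P \<eta>bar HB a r j))"

definition effective_damping ::
  "crdrs_params \<Rightarrow> real \<Rightarrow> 'a::euclidean_space qn_model \<Rightarrow> 'a \<Rightarrow> 'a \<Rightarrow> real" where
  "effective_damping P \<eta>bar HB a r = 1 - (\<Prod>j<rollK P. 1 - rollout_damping P \<eta>bar HB a r j)"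

lemma rollout_closed_form:
  assumes "inverse_pair H B"
  shows "rollout P \<eta>bar (H, B) a r n =
    (a - (1 - (\<Prod>j<n. 1 - rollout_damping P \<eta>bar (H, B) a r j)) *\<^sub>R H r,
     (\<Prod>j<n. 1 - rollout_damping P \<eta>bar (H, B) a r j) *\<^sub>R r)"
proof (induction n)
  case (Suc n)
  have BH: "B (H v) = v" for v
    using assms by (metis blinfun_apply_blinfun_compose id_blinfun.rep_eq inverse_pair_def)
  show ?case
    unfolding rollout.simps Let_def
    using Suc.IH
    by (simp add: rollout_damping_def BH blinfun.bilinear_simps algebra_simps)
qed simp


section \<open>Acceptance tests and fallback\<close>

definition descent_test :: "crdrs_params \<Rightarrow> ('a::euclidean_space \<Rightarrow> real) \<Rightarrow> 'a \<Rightarrow> 'a \<Rightarrow> 'a \<Rightarrow> bool" where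
  "descent_test P f z a y \<longleftrightarrow> resid (gam P) f z a \<bullet> (y - a) < 0"

definition armijo_test ::
  "crdrs_params \<Rightarrow> real \<Rightarrow> ('a::euclidean_space \<Rightarrow> real) \<Rightarrow> 'a \<Rightarrow> 'a \<Rightarrow> 'a \<Rightarrow> bool" where
  "armijo_test P c f z a y \<longleftrightarrow>
     phi (gam P) f z y \<le> phi (gam P) f z a + c * (resid (gam P) f z a \<bullet> (y - a))"

definition residual_test ::
  "crdrs_params \<Rightarrow> real \<Rightarrow> ('a::euclidean_space \<Rightarrow> real) \<Rightarrow> 'a \<Rightarrow> 'a \<Rightarrow> 'a \<Rightarrow> bool" where
  "residual_test P \<theta> f z a y \<longleftrightarrow>
     norm (resid (gam P) f z y) \<le> mconst P / Lconst P * \<theta> * norm (resid (gam P) f z a)"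

definition fallback_iterate ::
  "crdrs_params \<Rightarrow> ('a::euclidean_space \<Rightarrow> real) \<Rightarrow> 'a \<Rightarrow> 'a \<Rightarrow> nat \<Rightarrow> 'a" where
  "fallback_iterate P f z a j =
     ((\<lambda>u. u - (2 / (mconst P + Lconst P)) *\<^sub>R resid (gam P) f z u) ^^ j) a"

text \<open>The outcome of the acceptance decision: the new point, the points at which a new gradient of
  \<open>f\<close> is evaluated, and whether the fallback block is called. The gradient at the anchor \<open>a\<close> is
  stored from the previous iteration, so it is not a new one.\<close>

record 'a block_outcome =
  new_point :: 'a
  new_gradients :: "'a list"
  fallback_called :: bool

definition accept_or_fallback ::
  "crdrs_params \<Rightarrow> ('a::euclidean_space \<Rightarrow> real) \<Rightarrow> 'a \<Rightarrow> 'a \<Rightarrow> 'a \<Rightarrow> 'a block_outcome" where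
  "accept_or_fallback P f z a y =
     (if descent_test P f z a y \<and> armijo_test P (cA P) f z a y \<and> residual_test P (thQ P) f z a y
      then \<lparr>new_point = y, new_gradients = [y], fallback_called = False\<rparr>
      else \<lparr>new_point = fallback_iterate P f z a (fbb P),
            new_gradients = y # map (fallback_iterate P f z a) [1..<Suc (fbb P)],
            fallback_called = True\<rparr>)"


section \<open>Runs of the certified CR-DRS algorithm\<close>

text \<open>The sequence \<open>a\<close> is shifted by one: \<open>a k\<close> stands for the anchor \<open>a\<^sub>k\<^sub>-\<^sub>1\<close>, so \<open>a 0\<close> is the
  input \<open>a\<^sub>-\<^sub>1\<close>, and \<open>x k = a (Suc k)\<close>. The maps \<open>clip k\<close> are arbitrary modifications of the predicted
  displacement (clipping, truncation, an explicit cap on the effective damping); \<open>clip k = id\<close> is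
  the algorithm without any of these. The caps \<open>\<eta>bar k\<close> may come from any policy.\<close>

definition crdrs_run ::
  "crdrs_params \<Rightarrow> ('a::euclidean_space \<Rightarrow> real) \<Rightarrow> ('a \<Rightarrow> ereal) \<Rightarrow> (nat \<Rightarrow> real) \<Rightarrow> (nat \<Rightarrow> 'a \<Rightarrow> 'a) \<Rightarrow>
   (nat \<Rightarrow> 'a) \<Rightarrow> (nat \<Rightarrow> 'a) \<Rightarrow> (nat \<Rightarrow> ('a \<times> 'a) list) \<Rightarrow> (nat \<Rightarrow> 'a \<Rightarrow>\<^sub>L 'a) \<Rightarrow> (nat \<Rightarrow> 'a \<Rightarrow>\<^sub>L 'a) \<Rightarrow>
   (nat \<Rightarrow> 'a) \<Rightarrow> (nat \<Rightarrow> 'a block_outcome) \<Rightarrow> bool" where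
  "crdrs_run P f g \<eta>bar clip z a M H B xhat out \<longleftrightarrow>
     params_ok P \<and> (\<forall>k. 0 < \<eta>bar k \<and> \<eta>bar k \<le> 1) \<and> initial_memory_ok P f (M 0) \<and>
     (\<forall>k. let r = resid (gam P) f (z k); rbar = r (a k); x = new_point (out k) in
        (H k, B k) = build_model P (M k) \<and>
        xhat k = a k + clip k (fst (rollout P (\<eta>bar k) (H k, B k) (a k) rbar (rollK P)) - a k) \<and>
        out k = accept_or_fallback P f (z k) (a k) (xhat k) \<and>
        M (Suc k) = update_memory P (H k, B k) (x - a k, r x - rbar) (M k) \<and>
        z (Suc k) = z k + (2 * alp P) *\<^sub>R (prox (gam P) g (2 *\<^sub>R x - z k) - x) \<and>
        a (Suc k) = x)"

end

theory Submission
  imports Defs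
begin

text \<open>The prox point \<open>p\<^sub>k\<close> is the zero of the residual \<open>r\<^sub>k\<close>, so \<open>r\<^sub>k(a\<^sub>k\<^sub>-\<^sub>1)\<close> is the mean Hessian applied
  to \<open>d\<^sub>k\<close>. With \<open>H\<^sub>k = B\<^sub>k\<^sup>-\<^sup>1\<close> the candidate error becomes
  \<open>(1 - \<eta>) d + \<eta> H (B - G) d + \<xi>\<close>, which is \<open>o(\<parallel>d\<parallel>)\<close>. The descent and residual tests then follow
  from the strong monotonicity and Lipschitz continuity of \<open>r\<^sub>k\<close>. For the Armijo test, Hessian
  continuity makes the trapezoid rule exact up to \<open>o(\<parallel>d\<parallel>\<^sup>2)\<close>: the decrease from \<open>a\<^sub>k\<^sub>-\<^sub>1\<close> to \<open>p\<^sub>k\<close>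
  is half of \<open>r\<^sub>k(a\<^sub>k\<^sub>-\<^sub>1) \<bullet> d\<^sub>k\<close>, which beats the demanded fraction \<open>c < 1/2\<close>.\<close>

section \<open>Gradient inequalities from strong convexity\<close>

lemma has_real_derivative_along_line:
  fixes f :: "'a::euclidean_space \<Rightarrow> real"
  assumes "f differentiable (at (x + t *\<^sub>R v))"
  shows "((\<lambda>t. f (x + t *\<^sub>R v)) has_real_derivative grad f (x + t *\<^sub>R v) \<bullet> v) (at t)"
proof -
  have "(f has_derivative (\<lambda>h. h \<bullet> grad f (x + t *\<^sub>R v))) (at (x + t *\<^sub>R v))"
    using GDERIV_grad[OF assms] by (simp add: gderiv_def)
  moreover have "((\<lambda>t. x + t *\<^sub>R v) has_derivative (\<lambda>h. h *\<^sub>R v)) (at t)"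
    by (auto intro!: derivative_eq_intros)
  ultimately have "((\<lambda>t. f (x + t *\<^sub>R v)) has_derivative (\<lambda>h. (h *\<^sub>R v) \<bullet> grad f (x + t *\<^sub>R v))) (at t)"
    by (rule has_derivative_compose[rotated])
  then show ?thesis
    by (simp add: has_field_derivative_def inner_commute mult.commute[of _ "v \<bullet> _"] mult_commute_abs)
qed

text \<open>Strong convexity on the segment from \<open>x\<close> to \<open>y\<close> bounds the
  difference quotient of \<open>f\<close> at \<open>x\<close>; as \<open>t\<close> decreases to 0
  the quotient tends to the directional derivative and the factor \<open>1 - t\<close> of the
  quadratic term to 1.\<close>

lemma strongly_convex_above_tangent:
  fixes f :: "'a::euclidean_space \<Rightarrow> real"
  assumes "strongly_convex \<sigma> f" "f differentiable (at x)"
  shows "f x + grad f x \<bullet> (y - x) + \<sigma> / 2 * (norm (y - x))\<^sup>2 \<le> f y"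
proof -
  define h where "h t = f (x + t *\<^sub>R (y - x))" for t
  have "(h has_real_derivative grad f x \<bullet> (y - x)) (at 0)"
    using has_real_derivative_along_line[of f x 0 "y - x"] assms(2) by (simp add: h_def[abs_def])
  then have "((\<lambda>t. (h t - f x) / t) \<longlongrightarrow> grad f x \<bullet> (y - x)) (at 0)"
    by (simp add: DERIV_def h_def)
  then have lim1: "((\<lambda>t. (h t - f x) / t) \<longlongrightarrow> grad f x \<bullet> (y - x)) (at_right 0)"
    by (rule filterlim_mono) (auto intro: at_le)
  have lim2: "((\<lambda>t. f y - f x - \<sigma> / 2 * (1 - t) * (norm (y - x))\<^sup>2) \<longlongrightarrow>
      f y - f x - \<sigma> / 2 * (1 - 0) * (norm (y - x))\<^sup>2) (at_right 0)"
    by (intro tendsto_intros)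
  have "(h t - f x) / t \<le> f y - f x - \<sigma> / 2 * (1 - t) * (norm (y - x))\<^sup>2"
    if t: "0 < t" "t < 1" for t
  proof -
    have "h t \<le> (1 - t) * f x + t * f y - \<sigma> / 2 * t * (1 - t) * (norm (x - y))\<^sup>2"
    proof -
      have "x + t *\<^sub>R (y - x) = (1 - t) *\<^sub>R x + t *\<^sub>R y"
        by (simp add: algebra_simps)
      then show ?thesis
        using assms(1) t by (simp add: strongly_convex_def h_def)
    qed
    then have "h t - f x \<le> t * (f y - f x - \<sigma> / 2 * (1 - t) * (norm (y - x))\<^sup>2)"
      by (simp add: algebra_simps norm_minus_commute)
    then show ?thesis
      using t by (simp add: pos_divide_le_eq mult.commute)
  qed
  then have "\<forall>\<^sub>F t in at_right 0. (h t - f x) / t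
      \<le> f y - f x - \<sigma> / 2 * (1 - t) * (norm (y - x))\<^sup>2"
    by (auto simp: eventually_at_right_field intro!: exI[of _ 1])
  then have "grad f x \<bullet> (y - x) \<le> f y - f x - \<sigma> / 2 * (1 - 0) * (norm (y - x))\<^sup>2"
    by (rule tendsto_le[OF trivial_limit_at_right_real lim2 lim1])
  then show ?thesis by simp
qed

text \<open>Add the tangent inequalities at \<open>x\<close> and at \<open>y\<close>: the function
  values cancel and the two halves of the quadratic term sum to \<open>\<sigma>\<close>.\<close>

lemma strongly_convex_grad_monotone:
  fixes f :: "'a::euclidean_space \<Rightarrow> real"
  assumes "strongly_convex \<sigma> f" "f differentiable (at x)" "f differentiable (at y)"
  shows "\<sigma> * (norm (y - x))\<^sup>2 \<le> (grad f y - grad f x) \<bullet> (y - x)"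
  using strongly_convex_above_tangent[OF assms(1,2), of y]
    strongly_convex_above_tangent[OF assms(1,3), of x]
  by (simp add: norm_minus_commute algebra_simps)

section \<open>The residual map and the prox subproblem\<close>

lemma resid_diff: "resid \<gamma> f z x - resid \<gamma> f z y = \<gamma> *\<^sub>R (grad f x - grad f y) + (x - y)"
  by (simp add: resid_def algebra_simps)

lemma resid_strongly_monotone:
  fixes f :: "'a::euclidean_space \<Rightarrow> real"
  assumes "strongly_convex \<sigma> f" "f differentiable (at x)" "f differentiable (at y)" "0 \<le> \<gamma>"
  shows "(1 + \<gamma> * \<sigma>) * (norm (y - x))\<^sup>2 \<le> (resid \<gamma> f z y - resid \<gamma> f z x) \<bullet> (y - x)"
  using mult_left_mono[OF strongly_convex_grad_monotone[OF assms(1-3)] assms(4)]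
  unfolding resid_diff by (simp add: inner_add_left power2_norm_eq_inner algebra_simps)

lemma resid_lipschitz:
  fixes f :: "'a::euclidean_space \<Rightarrow> real"
  assumes "\<beta>-lipschitz_on UNIV (grad f)" "0 \<le> \<gamma>"
  shows "norm (resid \<gamma> f z x - resid \<gamma> f z y) \<le> (1 + \<gamma> * \<beta>) * norm (x - y)"
proof -
  have "norm (grad f x - grad f y) \<le> \<beta> * norm (x - y)"
    using lipschitz_onD[OF assms(1), of x y] by (simp add: dist_norm)
  then have "norm (\<gamma> *\<^sub>R (grad f x - grad f y)) \<le> \<gamma> * (\<beta> * norm (x - y))"
    using assms(2) by (simp add: mult_left_mono)
  then show ?thesis
    unfolding resid_diff
    using norm_triangle_ineq[of "\<gamma> *\<^sub>R (grad f x - grad f y)" "x - y"] by (simp add: algebra_simps)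
qed

text \<open>The bracket multiplied by \<open>\<gamma>\<close> is the Bregman divergence of
  \<open>f\<close>. Strong convexity bounds it below, and the trapezoid estimate later evaluates it
  up to second order.\<close>

lemma phi_diff:
  "phi \<gamma> f z y - phi \<gamma> f z x
    = \<gamma> * (f y - f x - grad f x \<bullet> (y - x)) + 1/2 * (norm (y - x))\<^sup>2 + resid \<gamma> f z x \<bullet> (y - x)"
  by (simp add: phi_def resid_def power2_norm_eq_inner inner_commute algebra_simps)

lemma phi_above_tangent:
  fixes f :: "'a::euclidean_space \<Rightarrow> real"
  assumes "strongly_convex \<sigma> f" "0 \<le> \<sigma>" "f differentiable (at x)" "0 \<le> \<gamma>"
  shows "phi \<gamma> f z x + resid \<gamma> f z x \<bullet> (y - x) + 1/2 * (norm (y - x))\<^sup>2 \<le> phi \<gamma> f z y"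
proof -
  have "0 \<le> \<sigma> / 2 * (norm (y - x))\<^sup>2" using assms(2) by simp
  then have "0 \<le> f y - f x - grad f x \<bullet> (y - x)"
    using strongly_convex_above_tangent[OF assms(1,3), of y] by linarith
  then have "0 \<le> \<gamma> * (f y - f x - grad f x \<bullet> (y - x))"
    using assms(4) by simp
  then show ?thesis using phi_diff[of \<gamma> f z y x] by linarith
qed

lemma phi_attains_min:
  fixes f :: "'a::euclidean_space \<Rightarrow> real"
  assumes "strongly_convex \<sigma> f" "0 \<le> \<sigma>" "\<And>x. f differentiable (at x)" "0 \<le> \<gamma>"
  shows "\<exists>x. \<forall>y. phi \<gamma> f z x \<le> phi \<gamma> f z y"
proof -
  \<comment> \<open>At distance at least \<open>R\<close> from \<open>z\<close>, the quadratic term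
    of the tangent bound at \<open>z\<close> outweighs the linear one, so minimizing over the
    compact ball is enough.\<close>
  define R where "R = 2 * norm (resid \<gamma> f z z)"
  have "continuous_on UNIV f"
    using assms(3) by (simp add: continuous_at_imp_continuous_on differentiable_imp_continuous_within)
  then have "continuous_on (cball z R) (phi \<gamma> f z)"
    unfolding phi_def by (intro continuous_intros) (auto intro: continuous_on_subset)
  moreover have zR: "z \<in> cball z R" by (simp add: R_def)
  ultimately obtain x where x: "\<forall>y\<in>cball z R. phi \<gamma> f z x \<le> phi \<gamma> f z y"
    using continuous_attains_inf[of "cball z R" "phi \<gamma> f z"] by auto
  have "phi \<gamma> f z x \<le> phi \<gamma> f z y" if "y \<notin> cball z R" for y
  proof -
    have far: "R \<le> norm (y - z)" using that by (simp add: dist_norm norm_minus_commute)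
    have "- (norm (resid \<gamma> f z z) * norm (y - z)) \<le> resid \<gamma> f z z \<bullet> (y - z)"
      using Cauchy_Schwarz_ineq2[of "resid \<gamma> f z z" "y - z"] by linarith
    moreover have "norm (resid \<gamma> f z z) * norm (y - z) \<le> 1/2 * (norm (y - z))\<^sup>2"
      using mult_right_mono[OF far norm_ge_zero[of "y - z"]] by (simp add: R_def power2_eq_square)
    ultimately have "phi \<gamma> f z z \<le> phi \<gamma> f z y"
      using phi_above_tangent[OF assms(1-4), of z z y] by linarith
    then show ?thesis using bspec[OF x zR] by linarith
  qed
  then show ?thesis using x by blast
qed

text \<open>\<open>prox\<close> picks its value by Hilbert choice, so attainment of the minimum is
  what makes that value a minimizer; the first-order condition then says that the gradient of
  \<open>phi\<close>, which is \<open>resid\<close>, vanishes.\<close>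

lemma resid_prox_eq_0:
  fixes f :: "'a::euclidean_space \<Rightarrow> real"
  assumes "strongly_convex \<sigma> f" "0 \<le> \<sigma>" "\<And>x. f differentiable (at x)" "0 \<le> \<gamma>"
  shows "resid \<gamma> f z (prox \<gamma> (\<lambda>x. ereal (f x)) z) = 0"
proof -
  define x where "x = prox \<gamma> (\<lambda>x. ereal (f x)) z"
  have prox_phi: "x = (ARG_MIN (\<lambda>y. ereal (phi \<gamma> f z y)) y. True)"
    by (simp add: x_def prox_def phi_def)
  have "is_arg_min (\<lambda>y. ereal (phi \<gamma> f z y)) (\<lambda>y. True) x"
    unfolding prox_phi arg_min_def
    by (rule someI_ex) (use phi_attains_min[OF assms] in \<open>auto simp: is_arg_min_linorder\<close>)
  then have x_min: "phi \<gamma> f z x \<le> phi \<gamma> f z y" for y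
    by (simp add: is_arg_min_linorder)
  have "phi \<gamma> f z differentiable (at x)"
    unfolding phi_def[abs_def] power2_norm_eq_inner
    by (intro derivative_intros assms(3) differentiable_inner)
  then have "(phi \<gamma> f z has_derivative (\<lambda>h. h \<bullet> resid \<gamma> f z x)) (at x)"
    using GDERIV_grad resid_eq_grad_phi[OF assms(3)] by (metis gderiv_def)
  then have "(\<lambda>h. h \<bullet> resid \<gamma> f z x) = (\<lambda>h. 0)"
    by (intro differential_zero_maxmin[OF UNIV_I open_UNIV]) (use x_min in auto)
  then show ?thesis
    unfolding x_def[symmetric] by (metis inner_eq_zero_iff)
qed

section \<open>Second-order expansions\<close>

lemma has_derivative_grad:
  fixes f :: "'a::euclidean_space \<Rightarrow> real"
  assumes "grad f differentiable (at x)"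
  shows "(grad f has_derivative blinfun_apply (hess f x)) (at x)"
proof -
  have "(grad f has_derivative frechet_derivative (grad f) (at x)) (at x)"
    using assms by (simp add: frechet_derivative_works)
  then show ?thesis
    by (simp add: hess_def bounded_linear_Blinfun_apply has_derivative_bounded_linear)
qed

lemma has_derivative_resid:
  fixes f :: "'a::euclidean_space \<Rightarrow> real"
  assumes "grad f differentiable (at x)"
  shows "(resid \<gamma> f z has_derivative blinfun_apply (\<gamma> *\<^sub>R hess f x + id_blinfun)) (at x)"
  unfolding resid_def[abs_def]
  by (auto intro!: derivative_eq_intros has_derivative_grad[OF assms] simp: blinfun.bilinear_simps)

lemma hess_phi:
  fixes f :: "'a::euclidean_space \<Rightarrow> real"
  assumes "\<And>x. f differentiable (at x)" "grad f differentiable (at x)"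
  shows "hess (phi \<gamma> f z) x = \<gamma> *\<^sub>R hess f x + id_blinfun"
proof -
  have "grad (phi \<gamma> f z) = resid \<gamma> f z"
    using resid_eq_grad_phi[OF assms(1)] by (simp add: fun_eq_iff)
  then show ?thesis
    using frechet_derivative_at[OF has_derivative_resid[OF assms(2)], of \<gamma> z, symmetric]
    by (simp add: hess_def[of "phi \<gamma> f z"] blinfun_apply_inverse)
qed

text \<open>This is the fundamental theorem of calculus along the segment. Evaluation at
  \<open>v\<close> is bounded linear on operators, so it may be moved outside the operator-valued
  integral.\<close>

lemma resid_diff_eq_mean_hess:
  fixes f :: "'a::euclidean_space \<Rightarrow> real"
  assumes "twice_cont_diff f"
  shows "resid \<gamma> f z (x + v) - resid \<gamma> f z x = integral {0..1} (\<lambda>t. hess (phi \<gamma> f z) (x + t *\<^sub>R v)) v"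
proof -
  have f1: "f differentiable (at y)" and f2: "grad f differentiable (at y)"
    and cont: "continuous_on UNIV (hess f)" for y
    using assms by (auto simp: twice_cont_diff_def)
  let ?G = "\<lambda>t. \<gamma> *\<^sub>R hess f (x + t *\<^sub>R v) + id_blinfun"
  have "((\<lambda>t. resid \<gamma> f z (x + t *\<^sub>R v)) has_vector_derivative ?G t v) (at t within {0..1})" for t
  proof -
    have "((\<lambda>t. x + t *\<^sub>R v) has_derivative (\<lambda>h. h *\<^sub>R v)) (at t within {0..1})"
      by (auto intro!: derivative_eq_intros)
    from has_derivative_compose[OF this has_derivative_resid[OF f2]]
    show ?thesis by (simp add: has_vector_derivative_def blinfun.scaleR_right)
  qed
  then have I: "((\<lambda>t. ?G t v) has_integral resid \<gamma> f z (x + v) - resid \<gamma> f z x) {0..1}"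
    using fundamental_theorem_of_calculus[of 0 1 "\<lambda>t. resid \<gamma> f z (x + t *\<^sub>R v)" "\<lambda>t. ?G t v"] by simp
  have "continuous_on {0..1} (\<lambda>t. hess f (x + t *\<^sub>R v))"
    by (rule continuous_on_compose2[OF cont]) (auto intro!: continuous_intros)
  then have "?G integrable_on {0..1}"
    by (intro integrable_continuous_interval continuous_intros)
  then have "((\<lambda>t. ?G t v) has_integral integral {0..1} ?G v) {0..1}"
    using has_integral_linear[of ?G _ "{0..1}" "\<lambda>A. blinfun_apply A v"]
    by (simp add: o_def integrable_integral blinfun.bounded_linear_left)
  then show ?thesis
    using has_integral_unique[OF I] hess_phi[OF f1 f2] by simp
qed

text \<open>The trapezoid rule is exact for a quadratic function with constant Hessian, so only the
  deviation of \<open>hess f\<close> from \<open>A\<close> counts. The factor 3/2 is 1 from a mean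
  value point plus 1/2 from the gradient at \<open>y\<close>.\<close>

lemma trapezoid_error_bound:
  fixes f :: "'a::euclidean_space \<Rightarrow> real"
  assumes f1: "\<And>x. f differentiable (at x)" and f2: "\<And>x. grad f differentiable (at x)"
    and S: "convex S" "x \<in> S" "y \<in> S"
    and A: "\<And>w. w \<in> S \<Longrightarrow> norm (hess f w - A) \<le> \<epsilon>"
  shows "\<bar>f y - f x - 1/2 * ((grad f x + grad f y) \<bullet> (y - x))\<bar> \<le> 3/2 * \<epsilon> * (norm (y - x))\<^sup>2"
proof -
  define v where "v = y - x"
  have seg: "x + t *\<^sub>R v \<in> S" if "t \<in> {0..1}" for t
    using convexD_alt[OF S, of t] that by (simp add: v_def algebra_simps)
  have \<epsilon>: "0 \<le> \<epsilon>" using A[OF S(2)] norm_ge_zero order_trans by blast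
  \<comment> \<open>Mean value inequality on the convex set \<open>S\<close> for
    \<open>grad f - A\<close>, whose derivative has norm at most \<open>\<epsilon>\<close>.\<close>
  have lin: "norm (grad f w - grad f x - A (w - x)) \<le> \<epsilon> * norm (w - x)" if "w \<in> S" for w
  proof -
    have "norm ((grad f w - A w) - (grad f x - A x)) \<le> \<epsilon> * norm (w - x)"
    proof (rule differentiable_bound[OF S(1) _ _ that S(2)])
      fix u assume "u \<in> S"
      show "((\<lambda>w. grad f w - A w) has_derivative blinfun_apply (hess f u - A)) (at u within S)"
        by (auto intro!: derivative_eq_intros has_derivative_at_withinI[OF has_derivative_grad[OF f2]]
            bounded_linear_imp_has_derivative blinfun.bounded_linear_right simp: blinfun.bilinear_simps)
      show "onorm (blinfun_apply (hess f u - A)) \<le> \<epsilon>"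
        using A[OF \<open>u \<in> S\<close>] by (simp add: norm_blinfun.rep_eq)
    qed
    then show ?thesis by (simp add: blinfun.bilinear_simps algebra_simps)
  qed
  \<comment> \<open>Subtracting the quadratic model from \<open>f\<close> on the segment leaves a
    function whose derivative is the gradient deviation controlled by \<open>lin\<close>, tested
    against \<open>v\<close>.\<close>
  define h where "h t = f (x + t *\<^sub>R v) - t * (grad f x \<bullet> v) - t\<^sup>2 / 2 * (A v \<bullet> v)" for t
  have dh: "(h has_real_derivative (grad f (x + t *\<^sub>R v) - grad f x - A (t *\<^sub>R v)) \<bullet> v) (at t)" for t
    unfolding h_def[abs_def]
    by (auto intro!: derivative_eq_intros has_real_derivative_along_line[OF f1]
        simp: inner_diff_left blinfun.bilinear_simps)
  obtain t where t: "0 < t" "t < 1"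
    and ht: "h 1 - h 0 = (grad f (x + t *\<^sub>R v) - grad f x - A (t *\<^sub>R v)) \<bullet> v"
    using MVT2[of 0 1 h "\<lambda>t. (grad f (x + t *\<^sub>R v) - grad f x - A (t *\<^sub>R v)) \<bullet> v"] dh by auto
  have bound: "\<bar>(grad f (x + t *\<^sub>R v) - grad f x - A (t *\<^sub>R v)) \<bullet> v\<bar> \<le> \<epsilon> * (norm v)\<^sup>2"
    if "0 \<le> t" "t \<le> 1" for t
  proof -
    have "norm (grad f (x + t *\<^sub>R v) - grad f x - A (t *\<^sub>R v)) \<le> \<epsilon> * (t * norm v)"
      using lin[OF seg, of t] that by simp
    also have "\<dots> \<le> \<epsilon> * norm v"
      using that \<epsilon> by (intro mult_left_mono) (auto intro: mult_left_le_one_le)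
    finally have "norm (grad f (x + t *\<^sub>R v) - grad f x - A (t *\<^sub>R v)) * norm v \<le> \<epsilon> * norm v * norm v"
      by (rule mult_right_mono) simp
    then show ?thesis
      using Cauchy_Schwarz_ineq2[of "grad f (x + t *\<^sub>R v) - grad f x - A (t *\<^sub>R v)" v]
      by (simp add: power2_eq_square)
  qed
  \<comment> \<open>The terms with \<open>A v \<bullet> v\<close> cancel, so the trapezoid error is
    expressed by gradient deviations at \<open>t\<close> and at 1 alone.\<close>
  have "f y - f x - 1/2 * ((grad f x + grad f y) \<bullet> v)
      = (h 1 - h 0) - 1/2 * ((grad f (x + 1 *\<^sub>R v) - grad f x - A (1 *\<^sub>R v)) \<bullet> v)"
    by (simp add: h_def v_def algebra_simps)
  then show ?thesis
    using bound[of t] bound[of 1] t ht unfolding v_def[symmetric] by (simp only:) linarith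
qed

text \<open>Since \<open>H (B d) = d\<close>, the vector \<open>d - \<eta> *\<^sub>R H (G d)\<close>
  equals \<open>(1 - \<eta>) *\<^sub>R d + \<eta> *\<^sub>R H ((B - G) d)\<close>; the model error
  thus enters only through its action on \<open>d\<close>.\<close>

lemma qn_candidate_error_bound:
  fixes H B G :: "'a::euclidean_space \<Rightarrow>\<^sub>L 'a"
  assumes "inverse_pair H B" and y: "y = p + d - \<eta> *\<^sub>R H (G d) + \<xi>"
  shows "norm (y - p) \<le> \<bar>1 - \<eta>\<bar> * norm d + \<bar>\<eta>\<bar> * norm H * norm ((B - G) d) + norm \<xi>"
proof -
  have "H (B d) = d"
    using assms(1) by (metis blinfun_apply_blinfun_compose id_blinfun.rep_eq inverse_pair_def)
  then have "y - p = (1 - \<eta>) *\<^sub>R d + \<eta> *\<^sub>R H ((B - G) d) + \<xi>"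
    by (simp add: y blinfun.bilinear_simps algebra_simps)
  moreover have "norm (\<eta> *\<^sub>R H ((B - G) d)) \<le> \<bar>\<eta>\<bar> * norm H * norm ((B - G) d)"
    using mult_left_mono[OF norm_blinfun[of H "(B - G) d"], of "\<bar>\<eta>\<bar>"] by (simp add: mult.assoc)
  ultimately show ?thesis
    using norm_triangle_ineq[of "(1 - \<eta>) *\<^sub>R d + \<eta> *\<^sub>R H ((B - G) d)" \<xi>]
      norm_triangle_ineq[of "(1 - \<eta>) *\<^sub>R d" "\<eta> *\<^sub>R H ((B - G) d)"] by simp
qed

theorem theorem4p1:
  fixes f :: "'a::euclidean_space \<Rightarrow> real" and g :: "'a \<Rightarrow> ereal"
    and P :: crdrs_params
    and \<eta>bar \<eta>cap \<eta>eff :: "nat \<Rightarrow> real" and clip :: "nat \<Rightarrow> 'a \<Rightarrow> 'a"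
    and z a xhat p d \<xi> :: "nat \<Rightarrow> 'a"
    and M :: "nat \<Rightarrow> ('a \<times> 'a) list"
    and H B Gbar :: "nat \<Rightarrow> 'a \<Rightarrow>\<^sub>L 'a"
    and out :: "nat \<Rightarrow> 'a block_outcome"
    and zstar pstar :: 'a
  assumes f_C2: "twice_cont_diff f"
    and f_convex: "convex_on UNIV f"
    and f_strong: "strongly_convex (sig P) f"
    and f_smooth: "(bet P)-lipschitz_on UNIV (grad f)"
    and g_pcc: "proper_closed_convex g"
    and run: "crdrs_run P f g \<eta>bar clip z a M H B xhat out"
    and zstar: "drs_map (alp P) (gam P) f g zstar = zstar"
    and pstar: "pstar = prox (gam P) (\<lambda>x. ereal (f x)) zstar"
    and p: "\<And>k. p k = prox (gam P) (\<lambda>x. ereal (f x)) (z k)"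
    and d: "\<And>k. d k = a k - p k"
    and Gbar: "\<And>k. Gbar k = integral {0..1} (\<lambda>t. hess (phi (gam P) f (z k)) (p k + t *\<^sub>R d k))"
    and d_lim: "d \<longlonglongrightarrow> 0"
    and d_nz: "\<And>k. d k \<noteq> 0"
    and a_lim: "a \<longlonglongrightarrow> pstar"
    and p_lim: "p \<longlonglongrightarrow> pstar"
    and hess_cont: "\<exists>U. open U \<and> pstar \<in> U \<and> continuous_on U (hess f)"
    and \<eta>cap: "\<And>k. 0 \<le> \<eta>cap k"
    and \<eta>eff: "\<And>k. \<eta>eff k =
          min (\<eta>cap k) (effective_damping P (\<eta>bar k) (H k, B k) (a k) (resid (gam P) f (z k) (a k)))"
    and candidate: "\<And>k. xhat k = a k - \<eta>eff k *\<^sub>R (H k) (resid (gam P) f (z k) (a k)) + \<xi> k"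
    and paired: "\<And>k. inverse_pair (H k) (B k)"
    and H_bdd: "bdd_above (range (\<lambda>k. norm (H k)))"
    and \<eta>eff_lim: "\<eta>eff \<longlonglongrightarrow> 1"
    and dennis_more: "(\<lambda>k. norm ((B k - Gbar k) (d k)) / norm (d k)) \<longlonglongrightarrow> 0"
    and \<xi>_lim: "(\<lambda>k. norm (\<xi> k) / norm (d k)) \<longlonglongrightarrow> 0"
  shows "(\<lambda>k. norm (xhat k - p k) / norm (a k - p k)) \<longlonglongrightarrow> 0 \<and>
    (\<forall>\<theta>\<in>{0<..<1}. \<forall>c\<in>{0<..<1/2}. \<forall>\<^sub>F k in sequentially.
       descent_test P f (z k) (a k) (xhat k) \<and>
       residual_test P \<theta> f (z k) (a k) (xhat k) \<and>
       armijo_test P c f (z k) (a k) (xhat k)) \<and>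
    (\<forall>\<^sub>F k in sequentially.
       new_point (out k) = xhat k \<and> new_gradients (out k) = [xhat k] \<and> \<not> fallback_called (out k))"
proof -
  note run_at = run[unfolded crdrs_run_def]
  define m L where "m = mconst P" and "L = Lconst P"
  have par: "params_ok P" using run_at by blast
  then have pos: "0 < gam P" "0 < sig P" "0 < bet P"
    by (auto simp: params_ok_def)
  then have mL: "0 < m" "0 < L"
    by (simp_all add: m_def L_def mconst_def Lconst_def add_pos_pos)
  have f1: "f differentiable (at y)" and f2: "grad f differentiable (at y)"
    and hess_c: "continuous_on UNIV (hess f)" for y
    using f_C2 by (auto simp: twice_cont_diff_def)
  let ?r = "\<lambda>k. resid (gam P) f (z k)"
  let ?\<phi> = "\<lambda>k. phi (gam P) f (z k)"
  \<comment> \<open>\<open>q\<close> is the error ratio to be sent to 0; through \<open>ne\<close>,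
    all later estimates become multiples of \<open>norm (d k)\<close> or its square.\<close>
  define e q where "e k = xhat k - p k" and "q k = norm (e k) / norm (d k)" for k
  have rp: "?r k (p k) = 0" for k
    unfolding p by (rule resid_prox_eq_0[OF f_strong _ f1]) (use pos in auto)
  have a_eq: "a k = p k + d k" for k by (simp add: d)
  have ra: "?r k (a k) = Gbar k (d k)" for k
    using resid_diff_eq_mean_hess[OF f_C2, of "gam P" "z k" "p k" "d k"] rp by (simp add: a_eq Gbar)
  have nd: "0 < norm (d k)" for k using d_nz by simp
  have ne: "norm (e k) = q k * norm (d k)" for k using nd[of k] by (simp add: q_def)
  have q0: "0 \<le> q k" for k by (simp add: q_def)

  \<comment> \<open>Superlinear decrease of the candidate error\<close>
  obtain C where C: "norm (H k) \<le> C" for k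
    using H_bdd unfolding bdd_above_def by auto
  let ?b = "\<lambda>k. \<bar>1 - \<eta>eff k\<bar> + \<bar>\<eta>eff k\<bar> * C * (norm ((B k - Gbar k) (d k)) / norm (d k))
      + norm (\<xi> k) / norm (d k)"
  have q_le: "q k \<le> ?b k" for k
  proof -
    have "norm (e k) \<le> \<bar>1 - \<eta>eff k\<bar> * norm (d k)
        + \<bar>\<eta>eff k\<bar> * norm (H k) * norm ((B k - Gbar k) (d k)) + norm (\<xi> k)"
      unfolding e_def
      by (rule qn_candidate_error_bound[OF paired]) (simp only: candidate ra, simp add: a_eq)
    also have "\<dots> \<le> \<bar>1 - \<eta>eff k\<bar> * norm (d k)
        + \<bar>\<eta>eff k\<bar> * C * norm ((B k - Gbar k) (d k)) + norm (\<xi> k)"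
      by (intro add_mono mult_right_mono mult_left_mono C) auto
    finally have "q k \<le> (\<bar>1 - \<eta>eff k\<bar> * norm (d k)
        + \<bar>\<eta>eff k\<bar> * C * norm ((B k - Gbar k) (d k)) + norm (\<xi> k)) / norm (d k)"
      unfolding q_def by (rule divide_right_mono) simp
    also have "\<dots> = ?b k" using nd[of k] by (simp add: add_divide_distrib)
    finally show ?thesis .
  qed
  have "?b \<longlonglongrightarrow> \<bar>1 - 1\<bar> + \<bar>1\<bar> * C * 0 + 0"
    by (intro tendsto_intros \<eta>eff_lim dennis_more \<xi>_lim)
  then have b_lim: "?b \<longlonglongrightarrow> 0" by simp
  have q_lim: "q \<longlonglongrightarrow> 0"
    by (rule tendsto_sandwich[OF _ _ tendsto_const b_lim])
      (intro always_eventually allI q0 q_le)+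

  \<comment> \<open>Residual estimates around the prox point\<close>
  have r_lip: "norm (?r k x) \<le> L * norm (x - p k)" for k x
    using resid_lipschitz[OF f_smooth, of "gam P" "z k" x "p k"] pos rp by (simp add: L_def Lconst_def)
  have rd_ge: "m * (norm (d k))\<^sup>2 \<le> ?r k (a k) \<bullet> d k" for k
    using resid_strongly_monotone[OF f_strong f1 f1, of "gam P" "p k" "a k" "z k"] pos rp
    by (simp add: m_def mconst_def a_eq)
  have re_le: "\<bar>?r k (a k) \<bullet> e k\<bar> \<le> L * q k * (norm (d k))\<^sup>2" for k
  proof -
    have "\<bar>?r k (a k) \<bullet> e k\<bar> \<le> norm (?r k (a k)) * norm (e k)" by (rule Cauchy_Schwarz_ineq2)
    also have "\<dots> \<le> L * norm (d k) * norm (e k)"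
      using r_lip[of k "a k"] by (intro mult_right_mono) (auto simp: a_eq)
    finally show ?thesis by (simp add: ne power2_eq_square mult_ac)
  qed
  have r_ge: "m * norm (d k) \<le> norm (?r k (a k))" for k
  proof -
    have "m * norm (d k) * norm (d k) \<le> norm (?r k (a k)) * norm (d k)"
      using rd_ge[of k] norm_cauchy_schwarz[of "?r k (a k)" "d k"] by (simp add: power2_eq_square)
    then show ?thesis using nd[of k] by simp
  qed
  \<comment> \<open>The actual displacement is the exact step \<open>- d k\<close> to the prox
    point, perturbed by \<open>e k\<close>; the slope is therefore at most \<open>- m\<close> times
    the squared norm of \<open>d k\<close>, up to the error in \<open>re_le\<close>.\<close>
  have step: "xhat k - a k = e k - d k" for k by (simp add: e_def d)

  \<comment> \<open>The three acceptance tests\<close>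
  have descent: "\<forall>\<^sub>F k in sequentially. descent_test P f (z k) (a k) (xhat k)"
  proof -
    have "(\<lambda>k. L * q k) \<longlonglongrightarrow> L * 0" by (intro tendsto_intros q_lim)
    then have "\<forall>\<^sub>F k in sequentially. L * q k < m"
      by (rule order_tendstoD) (use mL in simp)
    then show ?thesis
    proof eventually_elim
      case (elim k)
      have "L * q k * (norm (d k))\<^sup>2 < m * (norm (d k))\<^sup>2" using elim nd[of k] by simp
      then show ?case
        using re_le[of k] rd_ge[of k] unfolding descent_test_def step inner_diff_right by linarith
    qed
  qed
  have residual: "\<forall>\<^sub>F k in sequentially. residual_test P \<theta> f (z k) (a k) (xhat k)"
    if "0 < \<theta>" for \<theta>
  proof -
    have "(\<lambda>k. L * q k) \<longlonglongrightarrow> L * 0" by (intro tendsto_intros q_lim)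
    \<comment> \<open>One factor \<open>m\<close> comes from the test itself, the other from
      \<open>r_ge\<close>, which bounds the residual at the anchor below by
      \<open>m * norm (d k)\<close>.\<close>
    then have "\<forall>\<^sub>F k in sequentially. L * q k < m / L * \<theta> * m"
      by (rule order_tendstoD) (use mL that in simp)
    then show ?thesis
    proof eventually_elim
      case (elim k)
      have "norm (?r k (xhat k)) \<le> L * q k * norm (d k)"
        using r_lip[of k "xhat k"] by (simp add: e_def[symmetric] ne)
      also have "\<dots> \<le> m / L * \<theta> * m * norm (d k)"
        using elim by (intro mult_right_mono) auto
      also have "\<dots> \<le> m / L * \<theta> * norm (?r k (a k))"
        unfolding mult.assoc[of _ m "norm _"] using mL that by (intro mult_left_mono r_ge) auto
      finally show ?case by (simp add: residual_test_def m_def L_def)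
    qed
  qed
  have armijo: "\<forall>\<^sub>F k in sequentially. armijo_test P c f (z k) (a k) (xhat k)"
    if c: "0 < c" "c < 1/2" for c
  proof -
    \<comment> \<open>Of the slack \<open>(1/2 - c) m\<close>, one half absorbs the trapezoid error, the other the candidate error.\<close>
    define \<delta> where "\<delta> = (1/2 - c) * m / 2"
    have \<delta>: "0 < \<delta>" using c mL by (simp add: \<delta>_def)
    \<comment> \<open>Chosen so that the trapezoid constant 3/2, multiplied by \<open>gam P\<close>,
      turns \<open>\<epsilon>\<close> into exactly \<open>\<delta>\<close>.\<close>
    define \<epsilon> where "\<epsilon> = 2/3 * \<delta> / gam P"
    have \<epsilon>: "0 < \<epsilon>" using \<delta> pos by (simp add: \<epsilon>_def)
    obtain \<rho> where \<rho>: "0 < \<rho>" "\<And>w. dist w pstar < \<rho> \<Longrightarrow> dist (hess f w) (hess f pstar) < \<epsilon>"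
      using hess_c \<epsilon> unfolding continuous_on_iff by blast
    \<comment> \<open>The first term bounds the excess of \<open>phi\<close> at the candidate over
      its minimum, the second the change that \<open>e k\<close> makes in the demanded
      decrease.\<close>
    have "(\<lambda>k. L * (q k)\<^sup>2 + c * (L * q k)) \<longlonglongrightarrow> L * 0\<^sup>2 + c * (L * 0)"
      by (intro tendsto_intros q_lim)
    then have "\<forall>\<^sub>F k in sequentially. L * (q k)\<^sup>2 + c * (L * q k) < \<delta>"
      by (rule order_tendstoD) (use \<delta> in simp)
    moreover have "\<forall>\<^sub>F k in sequentially. dist (a k) pstar < \<rho>" "\<forall>\<^sub>F k in sequentially. dist (p k) pstar < \<rho>"
      using a_lim p_lim \<rho>(1) by (auto intro: tendstoD)
    ultimately show ?thesis
    proof eventually_elim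
      case (elim k)
      let ?D = "(norm (d k))\<^sup>2"
      \<comment> \<open>Both \<open>p k\<close> and \<open>a k\<close> lie in the ball of radius
        \<open>\<rho>\<close> around \<open>pstar\<close>; the constant comparison Hessian is the
        one at its center.\<close>
      have "\<bar>f (a k) - f (p k) - 1/2 * ((grad f (p k) + grad f (a k)) \<bullet> d k)\<bar> \<le> 3/2 * \<epsilon> * ?D"
        using trapezoid_error_bound[OF f1 f2 convex_ball[of pstar \<rho>], of "p k" "a k" "hess f pstar" \<epsilon>]
          elim \<rho>(2) by (force simp: a_eq dist_commute dist_norm[symmetric] less_imp_le)
      then have "\<bar>gam P * (f (a k) - f (p k) - 1/2 * ((grad f (p k) + grad f (a k)) \<bullet> d k))\<bar>
          \<le> gam P * (3/2 * \<epsilon> * ?D)"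
        using pos by (simp add: abs_mult)
      also have "gam P * (3/2 * \<epsilon> * ?D) = \<delta> * ?D"
        using pos by (simp add: \<epsilon>_def)
      \<comment> \<open>The trapezoid rule is exact on the quadratic part of \<open>phi\<close>, and
        the residual vanishes at \<open>p k\<close>, so of the two endpoint slopes only half of that
        at \<open>a k\<close> remains.\<close>
      also have "gam P * (f (a k) - f (p k) - 1/2 * ((grad f (p k) + grad f (a k)) \<bullet> d k))
          = ?\<phi> k (a k) - ?\<phi> k (p k) - 1/2 * (?r k (a k) \<bullet> d k)"
      proof -
        have "?r k (a k) = gam P *\<^sub>R (grad f (a k) - grad f (p k)) + d k"
          using resid_diff[of "gam P" f "z k" "a k" "p k"] rp d by simp
        then have "?r k (a k) \<bullet> d k = gam P * ((grad f (a k) - grad f (p k)) \<bullet> d k) + d k \<bullet> d k"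
          by (simp only: inner_add_left inner_scaleR_left)
        then show ?thesis
          using phi_diff[of "gam P" f "z k" "a k" "p k"]
          by (simp add: rp d[symmetric] inner_add_left inner_diff_left power2_norm_eq_inner algebra_simps)
      qed
      finally have a_bound: "\<bar>?\<phi> k (a k) - ?\<phi> k (p k) - 1/2 * (?r k (a k) \<bullet> d k)\<bar> \<le> \<delta> * ?D" .
      \<comment> \<open>The tangent is taken at \<open>xhat k\<close> and evaluated at
        \<open>p k\<close>; as the residual at \<open>xhat k\<close> is itself of order
        \<open>norm (e k)\<close>, the excess is quadratic in \<open>e k\<close>.\<close>
      have "?\<phi> k (xhat k) - ?\<phi> k (p k) \<le> ?r k (xhat k) \<bullet> e k"
        using phi_above_tangent[OF f_strong less_imp_le[OF pos(2)] f1 less_imp_le[OF pos(1)],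
            of "z k" "xhat k" "p k"] zero_le_power2[of "norm (p k - xhat k)"]
        unfolding e_def inner_diff_right by linarith
      also have "\<dots> \<le> norm (?r k (xhat k)) * norm (e k)" by (rule norm_cauchy_schwarz)
      also have "\<dots> \<le> L * norm (e k) * norm (e k)"
        using r_lip[of k "xhat k"] by (intro mult_right_mono) (auto simp: e_def)
      also have "\<dots> = L * (q k)\<^sup>2 * ?D" by (simp add: ne power2_eq_square)
      finally have x_bound: "?\<phi> k (xhat k) - ?\<phi> k (p k) \<le> L * (q k)\<^sup>2 * ?D" .
      have "(1/2 - c) * (m * ?D) \<le> (1/2 - c) * (?r k (a k) \<bullet> d k)"
        using c by (intro mult_left_mono rd_ge) auto
      then have d_bound: "2 * \<delta> * ?D \<le> 1/2 * (?r k (a k) \<bullet> d k) - c * (?r k (a k) \<bullet> d k)"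
        unfolding left_diff_distrib[symmetric] by (simp add: \<delta>_def mult.assoc)
      have "- (?r k (a k) \<bullet> e k) \<le> L * q k * ?D"
        using re_le[of k] by linarith
      then have "c * (- (?r k (a k) \<bullet> e k)) \<le> c * (L * q k * ?D)"
        using c by (intro mult_left_mono) auto
      then have e_bound: "- (c * (?r k (a k) \<bullet> e k)) \<le> c * (L * q k) * ?D"
        by (simp only: mult_minus_right mult.assoc)
      have "(L * (q k)\<^sup>2 + c * (L * q k)) * ?D \<le> \<delta> * ?D"
        using elim by (intro mult_right_mono) auto
      then have "L * (q k)\<^sup>2 * ?D + c * (L * q k) * ?D \<le> \<delta> * ?D"
        by (simp add: distrib_right)
      \<comment> \<open>The trapezoid error and the candidate terms cost at most
        \<open>\<delta> * ?D\<close> each, and \<open>d_bound\<close> provides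
        \<open>2 * \<delta> * ?D\<close>.\<close>
      then show ?case
        using a_bound x_bound d_bound e_bound
        unfolding armijo_test_def step inner_diff_right right_diff_distrib by linarith
    qed
  qed

  \<comment> \<open>Eventual acceptance without fallback\<close>
  have tests: "\<forall>\<^sub>F k in sequentially. descent_test P f (z k) (a k) (xhat k) \<and>
      residual_test P \<theta> f (z k) (a k) (xhat k) \<and> armijo_test P c f (z k) (a k) (xhat k)"
    if "\<theta> \<in> {0<..<1}" "c \<in> {0<..<1/2}" for \<theta> c
    using that by (intro eventually_conj descent residual armijo) auto
  have out: "out k = accept_or_fallback P f (z k) (a k) (xhat k)" for k
    using run_at by (auto simp: Let_def)
  \<comment> \<open>The algorithm's own \<open>thQ P\<close> and \<open>cA P\<close> lie in the open
    intervals by \<open>params_ok\<close>, so the accepting branch is eventually taken.\<close>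
  have "\<forall>\<^sub>F k in sequentially. descent_test P f (z k) (a k) (xhat k) \<and>
      residual_test P (thQ P) f (z k) (a k) (xhat k) \<and> armijo_test P (cA P) f (z k) (a k) (xhat k)"
    by (rule tests) (use par in \<open>auto simp: params_ok_def\<close>)
  then have "\<forall>\<^sub>F k in sequentially.
       new_point (out k) = xhat k \<and> new_gradients (out k) = [xhat k] \<and> \<not> fallback_called (out k)"
    by eventually_elim (simp add: out accept_or_fallback_def)
  with q_lim tests show ?thesis
    by (simp add: q_def[abs_def] e_def d)
qed

end
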